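(* Consider the Gaussian white noise model. Let the function class $\mathcal F$ be a subset of the direct sum $\mathcal F_1\oplus\cdots\oplus\mathcal F_p$ of spaces $\mathcal F_1,\dots,\mathcal F_p$ of functions $\mathbf R^d\to\mathbf R$ (the components $\mathcal F_j$ may be general function classes), and assume that for a positive constant $c>0$ $$\|f_1+\cdots+f_p\|_2^2\ \ge\ c\sum_{j=1}^p\|f_j\|_2^2\qquad (f_j\in\mathcal F_j,\ j=1,\dots,p).$$ Let $\delta>0$ and let $\mathcal F_\delta$ be a finite $\delta$-net of $\mathcal F$ in the $L_2$ metric that is a subset of $\mathcal F_{1,\delta}\oplus\cdots\oplus\mathcal F_{p,\delta}$, where each $\mathcal F_{j,\delta}$ is a finite subset of $\mathcal F_j$ with $\exp(\lambda_j)$ elements. Put $$\rho_j=\varrho(Q,\mathcal F_{j,\delta})=\max_{\phi,\phi'\in\mathcal F_{j,\delta},\ \phi\ne\phi'}\frac{\|Q(\phi-\phi')\|_2}{\|\phi-\phi'\|_2}.$$ Then the $\delta$-net minimizer $\hat f=\operatorname{argmin}_{\phi\in\mathcal F_\delta}\gamma_n(\phi)$ satisfies, for $f\in\mathcal F$, $$E\|\hat f-f\|_2^2\ \le\ 3\delta^2+32\,c^{-1}n^{-1}\Big[\sum_{j=1}^p\rho_j^2\lambda_j+\Big(\sum_{j=1}^p\rho_j\Big)^2\Big].$$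
   Context: Setting. $(\mathbf Y,\mathcal Y,\nu)$ is a Borel space with measure $\nu$; $A:L_2(\mathbf R^d)\to L_2(\mathbf Y,\nu)$ is a known linear operator with inverse $A^{-1}$, and $Q=(A^{-1})^*$ is the adjoint of the inverse, with domain $L_2(\mathbf R^d)$, satisfying $\int_{\mathbf R^d}(A^{-1}h)\,g=\int_{\mathbf Y}h\,(Qg)\,d\nu$ for $h\in L_2(\mathbf Y,\nu)$, $g\in L_2(\mathbf R^d)$. Gaussian white noise model: one observes $dY_n=(Af)\,d\nu+n^{-1/2}dW$ on $\mathbf Y$, where $W$ is the Brownian process on $\mathbf Y$: for $h_1,h_2\in L_2(\mathbf Y,\nu)$ the vector $(\int h_1dW,\int h_2dW)$ is centered Gaussian with variances $\|h_1\|_{2,\nu}^2,\|h_2\|_{2,\nu}^2$ and covariance $\int h_1h_2\,d\nu$. Elements of $\mathcal F_1\oplus\cdots\oplus\mathcal F_p$ are sums $f_1+\cdots+f_p$ with $f_j\in\mathcal F_j$; likewise for the finite sets $\mathcal F_{j,\delta}$. Empirical risk: $\gamma_n(g)=-2\int_{\mathbf Y}(Qg)\,dY_n+\|g\|_2^2$. A $\delta$-net of $\mathcal F$: for each $f\in\mathcal F$ there is $\phi\in\mathcal F_\delta$ with $\|f-\phi\|_2\le\delta$. $\|\cdot\|_2$ of a function on $\mathbf Y$ is the $L_2(\nu)$ norm. $E$ is expectation under the true $f$.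
   Formalization: The inequality ‖f_1+…+f_p‖² ≥ c Σ‖f_j‖² is assumed for f_j in the difference classes F_j − F_j, not F_j; the two agree when the F_j are linear spaces, and for general classes the claim as written fails. *)

theory Defs
  imports "HOL-Probability.Probability"
begin

text \<open>
  Elements of \<open>L\<^sub>2(M)\<close> are represented by square integrable functions.
  Equality in \<open>L\<^sub>2(M)\<close> is therefore equality almost everywhere, and operators
  have to respect it.
\<close>

definition L2 :: "'a measure \<Rightarrow> ('a \<Rightarrow> real) set" where
  "L2 M = {f \<in> borel_measurable M. integrable M (\<lambda>x. (f x)\<^sup>2)}"

definition l2_norm :: "'a measure \<Rightarrow> ('a \<Rightarrow> real) \<Rightarrow> real" where
  "l2_norm M f = sqrt (LINT x|M. (f x)\<^sup>2)"

definition l2_operator ::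
  "'a measure \<Rightarrow> 'b measure \<Rightarrow> (('a \<Rightarrow> real) \<Rightarrow> 'b \<Rightarrow> real) \<Rightarrow> bool" where
  "l2_operator M N T \<longleftrightarrow>
     (\<forall>f\<in>L2 M. T f \<in> L2 N) \<and>
     (\<forall>f\<in>L2 M. \<forall>g\<in>L2 M. (AE x in M. f x = g x) \<longrightarrow> (AE y in N. T f y = T g y)) \<and>
     (\<forall>f\<in>L2 M. \<forall>g\<in>L2 M. \<forall>a b. AE y in N. T (\<lambda>x. a * f x + b * g x) y = a * T f y + b * T g y)"

text \<open>
  The inverse is only required to be defined on the range of \<open>T\<close>, so \<open>T\<close> need not be onto;
  if it is, \<open>l2_range M N T = L2 N\<close>. Since every \<open>h\<close> is sent to each of its preimages,
  \<open>l2_inverse\<close> includes injectivity of \<open>T\<close>.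
\<close>

definition l2_range ::
  "'a measure \<Rightarrow> 'b measure \<Rightarrow> (('a \<Rightarrow> real) \<Rightarrow> 'b \<Rightarrow> real) \<Rightarrow> ('b \<Rightarrow> real) set" where
  "l2_range M N T = {h \<in> L2 N. \<exists>f\<in>L2 M. AE y in N. h y = T f y}"

definition l2_inverse ::
  "'a measure \<Rightarrow> 'b measure \<Rightarrow> (('a \<Rightarrow> real) \<Rightarrow> 'b \<Rightarrow> real) \<Rightarrow> (('b \<Rightarrow> real) \<Rightarrow> 'a \<Rightarrow> real) \<Rightarrow> bool" where
  "l2_inverse M N T S \<longleftrightarrow>
     (\<forall>h\<in>L2 N. \<forall>f\<in>L2 M. (AE y in N. h y = T f y) \<longrightarrow> S h \<in> L2 M \<and> (AE x in M. S h x = f x))"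

text \<open>\<open>Q\<close> is an everywhere defined adjoint of the operator \<open>S\<close> with domain \<open>D\<close>.\<close>

definition l2_adjoint ::
  "'a measure \<Rightarrow> 'b measure \<Rightarrow> ('b \<Rightarrow> real) set \<Rightarrow> (('b \<Rightarrow> real) \<Rightarrow> 'a \<Rightarrow> real) \<Rightarrow>
   (('a \<Rightarrow> real) \<Rightarrow> 'b \<Rightarrow> real) \<Rightarrow> bool" where
  "l2_adjoint M N D S Q \<longleftrightarrow>
     l2_operator M N Q \<and>
     (\<forall>h\<in>D. \<forall>g\<in>L2 M. (LINT x|M. S h x * g x) = (LINT y|N. h y * Q g y))"

text \<open>The variance \<open>v = 0\<close> is the point mass at \<open>0\<close>.\<close>

definition centered_gaussian :: "'w measure \<Rightarrow> ('w \<Rightarrow> real) \<Rightarrow> real \<Rightarrow> bool" where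
  "centered_gaussian P X v \<longleftrightarrow>
     X \<in> borel_measurable P \<and>
     (if v = 0 then AE \<omega> in P. X \<omega> = 0
      else distributed P lborel X (\<lambda>x. ennreal (normal_density 0 (sqrt v) x)))"

text \<open>
  A random vector is Gaussian iff all linear combinations of its entries are Gaussian;
  \<open>v\<close>, \<open>w\<close> are the variances and \<open>k\<close> is the covariance.
\<close>

definition centered_gaussian_pair ::
  "'w measure \<Rightarrow> ('w \<Rightarrow> real) \<Rightarrow> ('w \<Rightarrow> real) \<Rightarrow> real \<Rightarrow> real \<Rightarrow> real \<Rightarrow> bool" where
  "centered_gaussian_pair P X Y v w k \<longleftrightarrow>
     (\<forall>a b. centered_gaussian P (\<lambda>\<omega>. a * X \<omega> + b * Y \<omega>) (a\<^sup>2 * v + 2 * a * b * k + b\<^sup>2 * w))"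

text \<open>\<open>W h\<close> stands for the stochastic integral of \<open>h\<close> with respect to the Brownian process.\<close>

definition white_noise ::
  "'w measure \<Rightarrow> 'y measure \<Rightarrow> (('y \<Rightarrow> real) \<Rightarrow> 'w \<Rightarrow> real) \<Rightarrow> bool" where
  "white_noise P \<nu> W \<longleftrightarrow>
     (\<forall>h\<in>L2 \<nu>. \<forall>k\<in>L2 \<nu>.
        centered_gaussian_pair P (W h) (W k)
          ((l2_norm \<nu> h)\<^sup>2) ((l2_norm \<nu> k)\<^sup>2) (LINT y|\<nu>. h y * k y))"

text \<open>
  \<open>observation \<nu> W n s h\<close> is the integral of \<open>h\<close> with respect to
  \<open>dY\<^sub>n = s d\<nu> + n\<^sup>-\<^sup>1\<^sup>/\<^sup>2 dW\<close>, where \<open>s\<close> is the signal.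
\<close>

definition observation ::
  "'y measure \<Rightarrow> (('y \<Rightarrow> real) \<Rightarrow> 'w \<Rightarrow> real) \<Rightarrow> nat \<Rightarrow> ('y \<Rightarrow> real) \<Rightarrow> ('y \<Rightarrow> real) \<Rightarrow> 'w \<Rightarrow> real" where
  "observation \<nu> W n s h \<omega> = (LINT y|\<nu>. h y * s y) + real n powr (- 1 / 2) * W h \<omega>"

definition empirical_risk ::
  "'a measure \<Rightarrow> (('a \<Rightarrow> real) \<Rightarrow> 'y \<Rightarrow> real) \<Rightarrow> (('y \<Rightarrow> real) \<Rightarrow> 'w \<Rightarrow> real) \<Rightarrow>
   'w \<Rightarrow> ('a \<Rightarrow> real) \<Rightarrow> real" where
  "empirical_risk M Q Y \<omega> g = - 2 * Y (Q g) \<omega> + (l2_norm M g)\<^sup>2"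

definition sum_class :: "nat \<Rightarrow> (nat \<Rightarrow> ('a \<Rightarrow> real) set) \<Rightarrow> ('a \<Rightarrow> real) set" where
  "sum_class p F = {(\<lambda>x. \<Sum>j=1..p. f j x) | f. \<forall>j\<in>{1..p}. f j \<in> F j}"

definition l2_net :: "'a measure \<Rightarrow> real \<Rightarrow> ('a \<Rightarrow> real) set \<Rightarrow> ('a \<Rightarrow> real) set \<Rightarrow> bool" where
  "l2_net M \<delta> F N \<longleftrightarrow> (\<forall>f\<in>F. \<exists>\<phi>\<in>N. l2_norm M (\<lambda>x. f x - \<phi> x) \<le> \<delta>)"

definition sum_norm_bound :: "'a measure \<Rightarrow> real \<Rightarrow> nat \<Rightarrow> (nat \<Rightarrow> ('a \<Rightarrow> real) set) \<Rightarrow> bool" where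
  "sum_norm_bound M c p F \<longleftrightarrow>
     (\<forall>f. (\<forall>j\<in>{1..p}. f j \<in> F j) \<longrightarrow>
        (l2_norm M (\<lambda>x. \<Sum>j=1..p. f j x))\<^sup>2 \<ge> c * (\<Sum>j=1..p. (l2_norm M (f j))\<^sup>2))"

text \<open>
  For classes that are not linear spaces, \<open>sum_norm_bound\<close> on the classes themselves says nothing
  about the distance between two sums; it has to hold for the classes of differences.
  For linear spaces the two conditions coincide.
\<close>

definition diff_class :: "('a \<Rightarrow> real) set \<Rightarrow> ('a \<Rightarrow> real) set" where
  "diff_class S = {(\<lambda>x. u x - v x) | u v. u \<in> S \<and> v \<in> S}"

lemma diff_class_linear:
  assumes zero: "(\<lambda>x. 0) \<in> S"
    and lin: "\<And>u v a b. u \<in> S \<Longrightarrow> v \<in> S \<Longrightarrow> (\<lambda>x. a * u x + b * v x) \<in> S"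
  shows "diff_class S = S"
proof
  show "diff_class S \<subseteq> S"
    using lin[where a = 1 and b = "-1"] by (auto simp: diff_class_def)
  show "S \<subseteq> diff_class S"
  proof
    fix u assume "u \<in> S"
    then show "u \<in> diff_class S"
      unfolding diff_class_def using zero by (intro CollectI exI[of _ u] exI[of _ "\<lambda>x. 0"]) simp
  qed
qed

lemma sum_norm_bound_linear:
  assumes "\<And>j. j \<in> {1..p} \<Longrightarrow> (\<lambda>x. 0) \<in> F j"
    and "\<And>j u v a b. j \<in> {1..p} \<Longrightarrow> u \<in> F j \<Longrightarrow> v \<in> F j \<Longrightarrow> (\<lambda>x. a * u x + b * v x) \<in> F j"
  shows "sum_norm_bound M c p (\<lambda>j. diff_class (F j)) \<longleftrightarrow> sum_norm_bound M c p F"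
proof -
  have "diff_class (F j) = F j" if "j \<in> {1..p}" for j
    using that assms by (intro diff_class_linear) auto
  then show ?thesis by (simp add: sum_norm_bound_def)
qed

text \<open>
  The maximum is \<open>0\<close> if there is no pair \<open>\<phi> \<noteq> \<phi>'\<close>. Pairs that differ only on a null set
  contribute \<open>0 / 0 = 0\<close>.
\<close>

definition varrho ::
  "'a measure \<Rightarrow> 'y measure \<Rightarrow> (('a \<Rightarrow> real) \<Rightarrow> 'y \<Rightarrow> real) \<Rightarrow> ('a \<Rightarrow> real) set \<Rightarrow> real" where
  "varrho M \<nu> Q S = Max (insert 0
     {l2_norm \<nu> (Q (\<lambda>x. \<phi> x - \<phi>' x)) / l2_norm M (\<lambda>x. \<phi> x - \<phi>' x) | \<phi> \<phi>'.
        \<phi> \<in> S \<and> \<phi>' \<in> S \<and> \<phi> \<noteq> \<phi>'})"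

end

theory Submission
  imports Defs
begin

text \<open>
  Up to the constant \<open>-\<parallel>f\<parallel>\<^sup>2\<close> the empirical risk of \<open>g\<close> is \<open>\<parallel>g - f\<parallel>\<^sup>2 - 2 n\<^sup>-\<^sup>1\<^sup>/\<^sup>2 W(Qg)\<close>. Comparing the
  minimizer with a net point \<open>\<phi>\<^sub>0\<close> within \<open>\<delta>\<close> of \<open>f\<close> leaves the noise term
  \<open>2 n\<^sup>-\<^sup>1\<^sup>/\<^sup>2 (W(Q\<phi>) - W(Q\<phi>\<^sub>0))\<close>, which splits over the \<open>p\<close> components. Its \<open>j\<close>-th part is at most
  \<open>2 n\<^sup>-\<^sup>1\<^sup>/\<^sup>2 \<rho>\<^sub>j d\<^sub>j \<surd>R\<^sub>j\<close>, where \<open>d\<^sub>j\<close> is the distance of the components and \<open>R\<^sub>j\<close> dominates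
  \<open>exp \<lambda>\<^sub>j\<close> squared standard Gaussians, so that \<open>E R\<^sub>j \<le> 4 \<lambda>\<^sub>j + 2 ln 2\<close>. By AM-GM this is at most
  \<open>c d\<^sub>j\<^sup>2 / 4 + 4 \<rho>\<^sub>j\<^sup>2 R\<^sub>j / (c n)\<close>; the first terms sum to at most
  \<open>\<parallel>\<phi> - \<phi>\<^sub>0\<parallel>\<^sup>2 / 4 \<le> \<parallel>\<phi> - f\<parallel>\<^sup>2 / 2 + \<delta>\<^sup>2 / 2\<close> and are absorbed on the left.
\<close>

section \<open>Square integrable functions and their norms\<close>

lemma L2_mult_integrable:
  assumes "f \<in> L2 M" "g \<in> L2 M"
  shows "integrable M (\<lambda>x. f x * g x)"
proof (rule Bochner_Integration.integrable_bound)
  show "integrable M (\<lambda>x. (f x)\<^sup>2 + (g x)\<^sup>2)" "(\<lambda>x. f x * g x) \<in> borel_measurable M"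
    using assms by (auto simp: L2_def)
  have "\<bar>a * b\<bar> \<le> a\<^sup>2 + b\<^sup>2" for a b :: real
    using sum_squares_bound[of "\<bar>a\<bar>" "\<bar>b\<bar>"] mult_nonneg_nonneg[of "\<bar>a\<bar>" "\<bar>b\<bar>"]
    unfolding abs_mult power2_abs by linarith
  then show "AE x in M. norm (f x * g x) \<le> norm ((f x)\<^sup>2 + (g x)\<^sup>2)"
    by (intro AE_I2) (auto simp: order.trans[OF _ abs_ge_self])
qed

lemma L2_lin:
  assumes "f \<in> L2 M" "g \<in> L2 M"
  shows "(\<lambda>x. a * f x + b * g x) \<in> L2 M"
proof -
  have "integrable M (\<lambda>x. a\<^sup>2 * (f x)\<^sup>2 + 2 * a * b * (f x * g x) + b\<^sup>2 * (g x)\<^sup>2)"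
    using assms L2_mult_integrable[OF assms] by (auto simp: L2_def)
  moreover have "(a * f x + b * g x)\<^sup>2 = a\<^sup>2 * (f x)\<^sup>2 + 2 * a * b * (f x * g x) + b\<^sup>2 * (g x)\<^sup>2" for x
    by (simp add: power2_eq_square algebra_simps)
  ultimately show ?thesis using assms by (auto simp: L2_def)
qed

lemma L2_diff: "f \<in> L2 M \<Longrightarrow> g \<in> L2 M \<Longrightarrow> (\<lambda>x. f x - g x) \<in> L2 M"
  using L2_lin[of f M g 1 "-1"] by simp

lemma L2_sum:
  assumes "finite J" "\<And>j. j \<in> J \<Longrightarrow> f j \<in> L2 M"
  shows "(\<lambda>x. \<Sum>j\<in>J. f j x) \<in> L2 M"
  using assms
proof (induction J)
  case empty
  show ?case by (simp add: L2_def)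
next
  case (insert i J)
  then show ?case using L2_lin[of "f i" M "\<lambda>x. \<Sum>j\<in>J. f j x" 1 1] by simp
qed

lemma l2_norm_sq: "(l2_norm M f)\<^sup>2 = (LINT x|M. (f x)\<^sup>2)"
  by (simp add: l2_norm_def)

lemma l2_norm_nonneg: "0 \<le> l2_norm M f"
  by (simp add: l2_norm_def)

lemma l2_norm_sq_lin:
  assumes "f \<in> L2 M" "g \<in> L2 M"
  shows "(l2_norm M (\<lambda>x. a * f x + b * g x))\<^sup>2 =
    a\<^sup>2 * (l2_norm M f)\<^sup>2 + 2 * a * b * (LINT x|M. f x * g x) + b\<^sup>2 * (l2_norm M g)\<^sup>2"
proof -
  have "(a * f x + b * g x)\<^sup>2 = a\<^sup>2 * (f x)\<^sup>2 + 2 * a * b * (f x * g x) + b\<^sup>2 * (g x)\<^sup>2" for x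
    by (simp add: power2_eq_square algebra_simps)
  then show ?thesis
    using assms L2_mult_integrable[OF assms] by (simp add: l2_norm_sq L2_def)
qed

lemma l2_norm_diff_commute: "l2_norm M (\<lambda>x. f x - g x) = l2_norm M (\<lambda>x. g x - f x)"
  by (simp add: l2_norm_def power2_commute)

lemma l2_norm_cong_AE:
  assumes "f \<in> L2 M" "g \<in> L2 M" "AE x in M. f x = g x"
  shows "l2_norm M f = l2_norm M g"
  using assms unfolding l2_norm_def L2_def by (auto intro!: integral_cong_AE arg_cong[of _ _ sqrt])

lemma l2_norm_eq_0_AE:
  assumes "f \<in> L2 M" "l2_norm M f = 0"
  shows "AE x in M. f x = 0"
  using assms integral_nonneg_eq_0_iff_AE[of M "\<lambda>x. (f x)\<^sup>2"] by (auto simp: l2_norm_def L2_def)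

text \<open>With \<open>u = f - h\<close> and \<open>v = g - h\<close>, the gap between the two
  integrands is the square \<open>(u + v)^2\<close>. Taking the true function for \<open>h\<close>
  turns a distance between net points into losses.\<close>

lemma l2_norm_diff_sq_le:
  assumes "f \<in> L2 M" "g \<in> L2 M" "h \<in> L2 M"
  shows "(l2_norm M (\<lambda>x. f x - g x))\<^sup>2
    \<le> 2 * (l2_norm M (\<lambda>x. f x - h x))\<^sup>2 + 2 * (l2_norm M (\<lambda>x. g x - h x))\<^sup>2"
proof -
  have int: "integrable M (\<lambda>x. (u x - v x)\<^sup>2)" if "u \<in> L2 M" "v \<in> L2 M" for u v
    using L2_diff[OF that] by (simp add: L2_def)
  have le: "(a - b)\<^sup>2 \<le> 2 * (a - c)\<^sup>2 + 2 * (b - c)\<^sup>2" for a b c :: real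
    using zero_le_power2[of "a + b - 2 * c"] by (simp add: power2_eq_square algebra_simps)
  have "(LINT x|M. (f x - g x)\<^sup>2) \<le> (LINT x|M. 2 * (f x - h x)\<^sup>2 + 2 * (g x - h x)\<^sup>2)"
    using assms by (intro integral_mono le) (auto intro!: int)
  then show ?thesis using assms by (simp add: l2_norm_sq int)
qed

section \<open>Linear operators between L2 spaces and the ratio \<open>varrho\<close>\<close>

lemma l2_operator_L2: "l2_operator M N T \<Longrightarrow> f \<in> L2 M \<Longrightarrow> T f \<in> L2 N"
  by (simp add: l2_operator_def)

lemma l2_operator_cong:
  "l2_operator M N T \<Longrightarrow> f \<in> L2 M \<Longrightarrow> g \<in> L2 M \<Longrightarrow> AE x in M. f x = g x \<Longrightarrow>
   AE y in N. T f y = T g y"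
  by (simp add: l2_operator_def)

lemma l2_operator_lin:
  "l2_operator M N T \<Longrightarrow> f \<in> L2 M \<Longrightarrow> g \<in> L2 M \<Longrightarrow>
   AE y in N. T (\<lambda>x. a * f x + b * g x) y = a * T f y + b * T g y"
  by (simp add: l2_operator_def)

lemma l2_operator_diff:
  "l2_operator M N T \<Longrightarrow> f \<in> L2 M \<Longrightarrow> g \<in> L2 M \<Longrightarrow>
   AE y in N. T (\<lambda>x. f x - g x) y = T f y - T g y"
  using l2_operator_lin[of M N T f g 1 "-1"] by simp

lemma l2_operator_sum:
  assumes T: "l2_operator M N T" and "finite J" and "\<And>j. j \<in> J \<Longrightarrow> f j \<in> L2 M"
  shows "AE y in N. T (\<lambda>x. \<Sum>j\<in>J. f j x) y = (\<Sum>j\<in>J. T (f j) y)"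
  using assms(2,3)
proof (induction J)
  case empty
  have "(\<lambda>x. 0) \<in> L2 M" by (simp add: L2_def)
  from l2_operator_lin[OF T this this, of 0 0] show ?case by simp
next
  case (insert i J)
  have "AE y in N. T (\<lambda>x. 1 * f i x + 1 * (\<Sum>j\<in>J. f j x)) y =
      1 * T (f i) y + 1 * T (\<lambda>x. \<Sum>j\<in>J. f j x) y"
    using insert by (intro l2_operator_lin[OF T] L2_sum) auto
  moreover have "AE y in N. T (\<lambda>x. \<Sum>j\<in>J. f j x) y = (\<Sum>j\<in>J. T (f j) y)"
    using insert by auto
  ultimately show ?case
    by eventually_elim (use insert in simp)
qed

lemma finite_varrho_ratios:
  assumes "finite S"
  shows "finite {l2_norm N (Q (\<lambda>x. \<phi> x - \<phi>' x)) / l2_norm M (\<lambda>x. \<phi> x - \<phi>' x) | \<phi> \<phi>'.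
      \<phi> \<in> S \<and> \<phi>' \<in> S \<and> \<phi> \<noteq> \<phi>'}"
  by (rule finite_subset[OF _ finite_imageI[OF finite_cartesian_product[OF assms assms],
    of "\<lambda>(\<phi>, \<phi>'). l2_norm N (Q (\<lambda>x. \<phi> x - \<phi>' x)) / l2_norm M (\<lambda>x. \<phi> x - \<phi>' x)"]]) auto

lemma varrho_nonneg: "finite S \<Longrightarrow> 0 \<le> varrho M N Q S"
  unfolding varrho_def by (intro Max_ge) (auto intro: finite_varrho_ratios)

text \<open>At positive distance the quotient is one of those under the maximum. At distance zero
  the quotient carries no information, and the bound comes from \<open>Q\<close> itself: it respects
  equality a.e., so it sends the difference to 0 a.e.\<close>

lemma l2_operator_diff_norm_le_varrho:
  assumes Q: "l2_operator M N Q" and S: "finite S" "S \<subseteq> L2 M" and \<phi>: "\<phi> \<in> S" "\<psi> \<in> S"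
  shows "l2_norm N (\<lambda>y. Q \<phi> y - Q \<psi> y) \<le> varrho M N Q S * l2_norm M (\<lambda>x. \<phi> x - \<psi> x)"
proof -
  let ?d = "\<lambda>x. \<phi> x - \<psi> x"
  have L: "\<phi> \<in> L2 M" "\<psi> \<in> L2 M" using S \<phi> by auto
  note d = L2_diff[OF L]
  have eq: "l2_norm N (\<lambda>y. Q \<phi> y - Q \<psi> y) = l2_norm N (Q ?d)"
    using l2_operator_diff[OF Q L] L
    by (intro l2_norm_cong_AE L2_diff l2_operator_L2[OF Q] d) auto
  show ?thesis
  proof (cases "l2_norm M ?d = 0")
    case True
    have 0: "(\<lambda>x. 0) \<in> L2 M" by (simp add: L2_def)
    have "AE y in N. Q ?d y = Q (\<lambda>x. 0) y"
      using l2_norm_eq_0_AE[OF d True] by (intro l2_operator_cong[OF Q d 0])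
    moreover have "AE y in N. Q (\<lambda>x. 0) y = 0"
      using l2_operator_lin[OF Q 0 0, of 0 0] by simp
    ultimately have "AE y in N. Q ?d y = 0" by eventually_elim simp
    then have "l2_norm N (Q ?d) = l2_norm N (\<lambda>y. 0)"
      by (intro l2_norm_cong_AE l2_operator_L2[OF Q d]) (auto simp: L2_def)
    then have "l2_norm N (Q ?d) = 0" by (simp add: l2_norm_def)
    then show ?thesis using True eq by simp
  next
    case False
    then have ne: "\<phi> \<noteq> \<psi>" by (auto simp: l2_norm_def)
    have "l2_norm N (Q ?d) / l2_norm M ?d \<le> varrho M N Q S"
      unfolding varrho_def using \<phi> ne by (intro Max_ge finite.insertI finite_varrho_ratios S(1)) blast
    then show ?thesis
      using False l2_norm_nonneg[of M ?d] by (simp add: eq divide_le_eq)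
  qed
qed

section \<open>Moments and maxima of Gaussian variables\<close>

lemma centered_gaussian_second_moment:
  assumes X: "centered_gaussian P X v" and v: "0 \<le> v"
  shows "has_bochner_integral P (\<lambda>\<omega>. (X \<omega>)\<^sup>2) v"
proof (cases "v = 0")
  case True
  have "X \<in> borel_measurable P" using X by (simp add: centered_gaussian_def)
  moreover have "AE \<omega> in P. (X \<omega>)\<^sup>2 = 0"
    using X True by (auto simp: centered_gaussian_def)
  ultimately show ?thesis
    using True by (subst has_bochner_integral_cong_AE[where g="\<lambda>_. 0"]) auto
next
  case False
  then have D: "distributed P lborel X (normal_density 0 (sqrt v))" and s: "0 < sqrt v"
    using X v by (auto simp: centered_gaussian_def)
  have "integrable lborel (\<lambda>x. normal_density 0 (sqrt v) x * x\<^sup>2)"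
    using integrable_normal_moment[OF s, of 0 2] by simp
  moreover have "(LINT x|lborel. normal_density 0 (sqrt v) x * x\<^sup>2) = v"
    using integral_normal_moment_even[OF s, of 0 1] v by (simp add: fact_numeral)
  ultimately show ?thesis
    using distributed_integrable[OF D, of "\<lambda>x. x\<^sup>2"] distributed_integral[OF D, of "\<lambda>x. x\<^sup>2"]
    by (simp add: has_bochner_integral_iff)
qed

text \<open>The factor lowers the decay rate of the density from \<open>1 / (2 * v)\<close> to
  \<open>1 / (4 * v)\<close>, the rate of a Gaussian of variance \<open>2 * v\<close>;
  \<open>sqrt 2\<close> is the ratio of the normalizing constants. For \<open>v = 0\<close> division
  by zero makes the integrand 1.\<close>

lemma centered_gaussian_exp_square:
  assumes P: "prob_space P" and X: "centered_gaussian P X v" and v: "0 \<le> v"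
  shows "integrable P (\<lambda>\<omega>. exp ((X \<omega>)\<^sup>2 / (4 * v)))"
    and "(LINT \<omega>|P. exp ((X \<omega>)\<^sup>2 / (4 * v))) \<le> sqrt 2"
proof -
  interpret prob_space P by fact
  have "integrable P (\<lambda>\<omega>. exp ((X \<omega>)\<^sup>2 / (4 * v))) \<and>
    (LINT \<omega>|P. exp ((X \<omega>)\<^sup>2 / (4 * v))) \<le> sqrt 2"
  proof (cases "v = 0")
    case True
    then show ?thesis by (simp add: prob_space)
  next
    case False
    then have D: "distributed P lborel X (normal_density 0 (sqrt v))" and v': "0 < v"
      using X v by (auto simp: centered_gaussian_def)
    have eq: "normal_density 0 (sqrt v) x * exp (x\<^sup>2 / (4 * v)) =
        sqrt 2 * normal_density 0 (sqrt (2 * v)) x" for x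
    proof -
      have "sqrt (2 * pi * (sqrt (2 * v))\<^sup>2) = sqrt 2 * sqrt (2 * pi * (sqrt v)\<^sup>2)"
        using v' by (simp add: real_sqrt_mult[symmetric])
      moreover have "exp (- (x - 0)\<^sup>2 / (2 * (sqrt v)\<^sup>2)) * exp (x\<^sup>2 / (4 * v)) =
          exp (- (x - 0)\<^sup>2 / (2 * (sqrt (2 * v))\<^sup>2))"
        using v' by (simp add: exp_add[symmetric])
      ultimately show ?thesis
        unfolding normal_density_def by (simp add: mult.assoc)
    qed
    have s: "0 < sqrt (2 * v)" using v' by simp
    have "integrable lborel (\<lambda>x. normal_density 0 (sqrt v) x * exp (x\<^sup>2 / (4 * v)))"
      unfolding eq using s by auto
    moreover have "(LINT x|lborel. normal_density 0 (sqrt v) x * exp (x\<^sup>2 / (4 * v))) = sqrt 2"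
      unfolding eq using s by simp
    ultimately show ?thesis
      using distributed_integrable[OF D, of "\<lambda>x. exp (x\<^sup>2 / (4 * v))"]
        distributed_integral[OF D, of "\<lambda>x. exp (x\<^sup>2 / (4 * v))"]
      by simp
  qed
  then show "integrable P (\<lambda>\<omega>. exp ((X \<omega>)\<^sup>2 / (4 * v)))"
    and "(LINT \<omega>|P. exp ((X \<omega>)\<^sup>2 / (4 * v))) \<le> sqrt 2" by auto
qed

text \<open>
  The envelope \<open>R\<close> is the tangent bound \<open>m \<le> exp m / K - 1 + ln K\<close> at \<open>K = \<surd>2 card S\<close>, with
  \<open>exp m\<close> bounded by a sum over \<open>S\<close>; this replaces the maximum by something visibly integrable.
\<close>

lemma gaussian_maximal_envelope:
  assumes P: "prob_space P" and S: "finite S" "S \<noteq> {}"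
    and X: "\<And>s. s \<in> S \<Longrightarrow> centered_gaussian P (X s) (v s)" and v: "\<And>s. s \<in> S \<Longrightarrow> 0 \<le> v s"
  shows "\<exists>R. integrable P R \<and> (LINT \<omega>|P. R \<omega>) \<le> 4 * ln (card S) + 2 * ln 2 \<and>
    (\<forall>\<omega>. 0 \<le> R \<omega>) \<and> (AE \<omega> in P. \<forall>s\<in>S. (X s \<omega>)\<^sup>2 \<le> v s * R \<omega>)"
proof -
  interpret prob_space P by fact
  define K where "K = real (card S) * sqrt 2"
  have card: "0 < real (card S)" using S by (simp add: card_gt_0_iff)
  then have K: "0 < K" by (simp add: K_def)
  define U where "U s \<omega> = exp ((X s \<omega>)\<^sup>2 / (4 * v s))" for s \<omega>
  define R where "R \<omega> = 4 * ((\<Sum>s\<in>S. U s \<omega>) / K - 1 + ln K)" for \<omega>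
  have int: "integrable P (U s)" "(LINT \<omega>|P. U s \<omega>) \<le> sqrt 2" if "s \<in> S" for s
    using centered_gaussian_exp_square[OF P X[OF that] v[OF that]] by (auto simp: U_def[abs_def])
  have R_ge: "(X s \<omega>)\<^sup>2 / v s \<le> R \<omega>" if s: "s \<in> S" for s \<omega>
  proof -
    let ?m = "(X s \<omega>)\<^sup>2 / (4 * v s)"
    have "U s \<omega> \<le> (\<Sum>s\<in>S. U s \<omega>)"
      using s S(1) by (intro member_le_sum) (auto simp: U_def)
    then have "exp ?m / K \<le> (\<Sum>s\<in>S. U s \<omega>) / K"
      using K by (simp add: U_def divide_right_mono)
    moreover have "1 + (?m - ln K) \<le> exp ?m / K"
      using exp_ge_add_one_self[of "?m - ln K"] K by (simp add: exp_diff)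
    ultimately have "4 * ?m \<le> R \<omega>" unfolding R_def by argo
    then show ?thesis by simp
  qed
  have "integrable P R"
    unfolding R_def using int by (intro integrable_mult_right Bochner_Integration.integrable_add
      Bochner_Integration.integrable_diff integrable_divide Bochner_Integration.integrable_sum) auto
  moreover have "(LINT \<omega>|P. R \<omega>) \<le> 4 * ln (card S) + 2 * ln 2"
  proof -
    have "(LINT \<omega>|P. R \<omega>) = 4 * ((\<Sum>s\<in>S. LINT \<omega>|P. U s \<omega>) / K - 1 + ln K)"
      unfolding R_def using int by (simp add: prob_space)
    also have "(\<Sum>s\<in>S. LINT \<omega>|P. U s \<omega>) \<le> K"
      unfolding K_def using sum_mono[of S "\<lambda>s. LINT \<omega>|P. U s \<omega>" "\<lambda>_. sqrt 2"] int by simp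
    then have "(\<Sum>s\<in>S. LINT \<omega>|P. U s \<omega>) / K \<le> 1"
      using K by simp
    then have "4 * ((\<Sum>s\<in>S. LINT \<omega>|P. U s \<omega>) / K - 1 + ln K) \<le> 4 * ln K" by simp
    also have "4 * ln K = 4 * ln (card S) + 2 * ln 2"
      using card by (simp add: K_def ln_mult ln_sqrt)
    finally show ?thesis .
  qed
  \<comment> \<open>\<open>R\<close> dominates a nonnegative quotient at every outcome, because
    \<open>S\<close> has a member.\<close>
  moreover have "0 \<le> R \<omega>" for \<omega>
  proof -
    obtain s where s: "s \<in> S" using S by auto
    show ?thesis using R_ge[OF s, of \<omega>] v[OF s] by (meson divide_nonneg_nonneg order_trans zero_le_power2)
  qed
  moreover have "AE \<omega> in P. \<forall>s\<in>S. (X s \<omega>)\<^sup>2 \<le> v s * R \<omega>"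
  proof (rule AE_finite_allI[OF S(1)])
    fix s assume s: "s \<in> S"
    show "AE \<omega> in P. (X s \<omega>)\<^sup>2 \<le> v s * R \<omega>"
    \<comment> \<open>At variance zero the quotient in \<open>R_ge\<close> is 0 by convention and
      says nothing about \<open>X s\<close>; there the point mass at 0 gives the bound, and only
      a.e.\<close>
    proof (cases "v s = 0")
      case True
      then have "AE \<omega> in P. X s \<omega> = 0" using X[OF s] by (simp add: centered_gaussian_def)
      then show ?thesis by eventually_elim (simp add: True)
    next
      case False
      then have "0 < v s" using v[OF s] by simp
      then show ?thesis
        using R_ge[OF s] by (intro AE_I2) (simp add: pos_divide_le_eq mult.commute)
    qed
  qed
  ultimately show ?thesis by blast
qed

section \<open>White noise as a linear isometry, and the form of the empirical risk\<close>

lemma white_noise_lin: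
  assumes W: "white_noise P \<nu> W" and L: "h \<in> L2 \<nu>" "k \<in> L2 \<nu>"
  shows "centered_gaussian P (\<lambda>\<omega>. a * W h \<omega> + b * W k \<omega>) ((l2_norm \<nu> (\<lambda>y. a * h y + b * k y))\<^sup>2)"
  using assms unfolding l2_norm_sq_lin[OF L] white_noise_def centered_gaussian_pair_def
  by (simp add: mult.assoc mult.left_commute mult.commute)

lemma white_noise_diff:
  assumes "white_noise P \<nu> W" "h \<in> L2 \<nu>" "k \<in> L2 \<nu>"
  shows "centered_gaussian P (\<lambda>\<omega>. W h \<omega> - W k \<omega>) ((l2_norm \<nu> (\<lambda>y. h y - k y))\<^sup>2)"
  using white_noise_lin[OF assms, of 1 "-1"] by simp

text \<open>Polarization: the second moments of the sum and of the difference are known, and they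
  differ by four times the mixed moment.\<close>

lemma white_noise_isometry:
  assumes W: "white_noise P \<nu> W" and L: "h \<in> L2 \<nu>" "k \<in> L2 \<nu>"
  shows "has_bochner_integral P (\<lambda>\<omega>. W h \<omega> * W k \<omega>) (LINT y|\<nu>. h y * k y)"
proof -
  have "has_bochner_integral P (\<lambda>\<omega>. (W h \<omega> + b * W k \<omega>)\<^sup>2)
      ((l2_norm \<nu> (\<lambda>y. h y + b * k y))\<^sup>2)" for b
    using centered_gaussian_second_moment[OF white_noise_lin[OF W L, of 1 b]] by simp
  from has_bochner_integral_diff[OF this[of 1] this[of "-1"]]
  have "has_bochner_integral P (\<lambda>\<omega>. 4 * (W h \<omega> * W k \<omega>)) (4 * (LINT y|\<nu>. h y * k y))"
    unfolding l2_norm_sq_lin[OF L, of 1, simplified] by (simp add: power2_eq_square algebra_simps)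
  from has_bochner_integral_mult_right[OF this, of "1 / 4"] show ?thesis by simp
qed

text \<open>
  \<open>white_noise\<close> only prescribes pairwise laws; additivity follows since the variance of the
  defect expands into pairwise covariances.
\<close>

lemma white_noise_sum:
  assumes W: "white_noise P \<nu> W" and J: "finite J"
    and h: "h \<in> L2 \<nu>" and g: "\<And>j. j \<in> J \<Longrightarrow> g j \<in> L2 \<nu>"
    and eq: "AE y in \<nu>. h y = (\<Sum>j\<in>J. g j y)"
  shows "AE \<omega> in P. W h \<omega> = (\<Sum>j\<in>J. W (g j) \<omega>)"
proof -
  have expand: "(a - (\<Sum>j\<in>J. b j))\<^sup>2 = a * a - 2 * (\<Sum>j\<in>J. a * b j) + (\<Sum>i\<in>J. \<Sum>j\<in>J. b i * b j)"
    for a :: real and b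
    by (simp add: power2_eq_square algebra_simps sum_product sum_distrib_left)
  \<comment> \<open>\<open>V\<close> has two readings: the squared norm of the defect under
    \<open>\<nu>\<close>, which is 0, and, by the isometry, the second moment of the noise defect
    under \<open>P\<close>.\<close>
  define V where "V = (LINT y|\<nu>. h y * h y) - 2 * (\<Sum>j\<in>J. LINT y|\<nu>. h y * g j y) +
    (\<Sum>i\<in>J. \<Sum>j\<in>J. LINT y|\<nu>. g i y * g j y)"
  have "has_bochner_integral \<nu> (\<lambda>y. (h y - (\<Sum>j\<in>J. g j y))\<^sup>2) V"
    unfolding expand V_def
    by (intro has_bochner_integral_add has_bochner_integral_diff has_bochner_integral_mult_right
        has_bochner_integral_sum has_bochner_integral_integrable L2_mult_integrable h g)
  then have "V = (LINT y|\<nu>. (h y - (\<Sum>j\<in>J. g j y))\<^sup>2)"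
    by (simp add: has_bochner_integral_integral_eq)
  also have "\<dots> = 0"
    using eq by (intro integral_eq_zero_AE) auto
  finally have V: "V = 0" .
  have "has_bochner_integral P (\<lambda>\<omega>. (W h \<omega> - (\<Sum>j\<in>J. W (g j) \<omega>))\<^sup>2) V"
    unfolding expand V_def
    by (intro has_bochner_integral_add has_bochner_integral_diff has_bochner_integral_mult_right
        has_bochner_integral_sum white_noise_isometry[OF W] h g)
  then have "AE \<omega> in P. (W h \<omega> - (\<Sum>j\<in>J. W (g j) \<omega>))\<^sup>2 = 0"
    unfolding V by (subst integral_nonneg_eq_0_iff_AE[symmetric]) (auto simp: has_bochner_integral_iff)
  then show ?thesis by eventually_elim simp
qed

text \<open>The adjoint identity at \<open>h = A f\<close> turns the signal part of the observation
  into the inner product of \<open>g\<close> and \<open>f\<close>, since the inverse returns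
  \<open>f\<close> a.e.; completing the square does the rest. This holds at every outcome, so it
  applies to a random \<open>g\<close>.\<close>

lemma empirical_risk_white_noise:
  assumes A: "l2_operator M \<nu> A" and Ainv: "l2_inverse M \<nu> A Ainv"
    and Q: "l2_adjoint M \<nu> (l2_range M \<nu> A) Ainv Q"
    and f: "f \<in> L2 M" and g: "g \<in> L2 M"
  shows "empirical_risk M Q (observation \<nu> W n (A f)) \<omega> g =
    (l2_norm M (\<lambda>x. g x - f x))\<^sup>2 - (l2_norm M f)\<^sup>2 - 2 * real n powr (- 1 / 2) * W (Q g) \<omega>"
proof -
  have Af: "A f \<in> L2 \<nu>" by (rule l2_operator_L2[OF A f])
  have S: "Ainv (A f) \<in> L2 M" "AE x in M. Ainv (A f) x = f x"
    using Ainv Af f by (auto simp: l2_inverse_def)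
  have "A f \<in> l2_range M \<nu> A" using Af f by (auto simp: l2_range_def)
  then have "(LINT y|\<nu>. Q g y * A f y) = (LINT x|M. Ainv (A f) x * g x)"
    using Q g by (simp add: l2_adjoint_def mult.commute)
  also have "\<dots> = (LINT x|M. g x * f x)"
    using S f g by (intro integral_cong_AE) (auto simp: L2_def)
  finally have "(LINT y|\<nu>. Q g y * A f y) = (LINT x|M. g x * f x)" .
  moreover have "(l2_norm M (\<lambda>x. g x - f x))\<^sup>2 =
      (l2_norm M g)\<^sup>2 - 2 * (LINT x|M. g x * f x) + (l2_norm M f)\<^sup>2"
    using l2_norm_sq_lin[OF g f, of 1 "-1"] by simp
  ultimately show ?thesis
    by (simp add: empirical_risk_def observation_def algebra_simps)
qed

section \<open>Bounding the risk of the net minimizer\<close>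

text \<open>AM-GM in squared form, \<open>4 * a * b \<le> (a + b)^2\<close>, which avoids the root
  of \<open>R\<close>. The weights \<open>c / 4\<close> and \<open>4 / c\<close> are such that
  \<open>c\<close> cancels in the product.\<close>

lemma two_mult_le_weighted_squares:
  fixes c k d r R X :: real
  assumes c: "0 < c" and R: "0 \<le> R" and X: "X\<^sup>2 \<le> (r * d)\<^sup>2 * R"
  shows "2 * k * X \<le> c / 4 * d\<^sup>2 + 4 * k\<^sup>2 / c * (r\<^sup>2 * R)"
proof (rule power2_le_imp_le)
  let ?a = "c / 4 * d\<^sup>2" and ?b = "4 * k\<^sup>2 / c * (r\<^sup>2 * R)"
  have "(2 * k * X)\<^sup>2 \<le> (2 * k)\<^sup>2 * ((r * d)\<^sup>2 * R)"
    unfolding power_mult_distrib[of "2 * k" X] using X by (intro mult_left_mono) auto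
  also have "\<dots> = 4 * ?a * ?b"
    using c by (simp add: power2_eq_square)
  also have "\<dots> \<le> (?a + ?b)\<^sup>2"
    using zero_le_power2[of "?a - ?b"] unfolding power2_sum power2_diff by linarith
  finally show "(2 * k * X)\<^sup>2 \<le> (?a + ?b)\<^sup>2" .
  show "0 \<le> ?a + ?b" using c R by simp
qed

theorem theorem5:
  fixes \<nu> :: "'y measure"
    and P :: "'w measure"
    and A Q :: "(real ^ 'd \<Rightarrow> real) \<Rightarrow> 'y \<Rightarrow> real"
    and Ainv :: "('y \<Rightarrow> real) \<Rightarrow> real ^ 'd \<Rightarrow> real"
    and W :: "('y \<Rightarrow> real) \<Rightarrow> 'w \<Rightarrow> real"
    and n p :: nat
    and c \<delta> :: real
    and \<F> \<F>\<delta> :: "(real ^ 'd \<Rightarrow> real) set"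
    and F F\<delta> :: "nat \<Rightarrow> (real ^ 'd \<Rightarrow> real) set"
    and lam :: "nat \<Rightarrow> real"
    and f :: "real ^ 'd \<Rightarrow> real"
    and fhat :: "'w \<Rightarrow> real ^ 'd \<Rightarrow> real"
  defines "\<rho> \<equiv> \<lambda>j. varrho lborel \<nu> Q (F\<delta> j)"
  assumes A: "l2_operator lborel \<nu> A"
    and Ainv: "l2_inverse lborel \<nu> A Ainv"
    and Q: "l2_adjoint lborel \<nu> (l2_range lborel \<nu> A) Ainv Q"
    and P: "prob_space P"
    and W: "white_noise P \<nu> W"
    and n: "n \<ge> 1"
    and p: "p \<ge> 1"
    and F_L2: "\<And>j. j \<in> {1..p} \<Longrightarrow> F j \<subseteq> L2 lborel"
    and class_sub: "\<F> \<subseteq> sum_class p F"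
    and c: "c > 0"
    and bound: "sum_norm_bound lborel c p (\<lambda>j. diff_class (F j))"
    and \<delta>: "\<delta> > 0"
    and net: "l2_net lborel \<delta> \<F> \<F>\<delta>"
    and net_finite: "finite \<F>\<delta>"
    and net_sub: "\<F>\<delta> \<subseteq> sum_class p F\<delta>"
    and F\<delta>_sub: "\<And>j. j \<in> {1..p} \<Longrightarrow> F\<delta> j \<subseteq> F j"
    and F\<delta>_finite: "\<And>j. j \<in> {1..p} \<Longrightarrow> finite (F\<delta> j)"
    and F\<delta>_card: "\<And>j. j \<in> {1..p} \<Longrightarrow> real (card (F\<delta> j)) = exp (lam j)"
    and f: "f \<in> \<F>"
    and fhat_meas: "fhat \<in> measurable P (count_space \<F>\<delta>)"
    and fhat_min: "\<And>\<omega>. \<omega> \<in> space P \<Longrightarrow>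
      is_arg_min (empirical_risk lborel Q (observation \<nu> W n (A f)) \<omega>) (\<lambda>\<phi>. \<phi> \<in> \<F>\<delta>) (fhat \<omega>)"
  shows "prob_space.expectation P (\<lambda>\<omega>. (l2_norm lborel (\<lambda>x. fhat \<omega> x - f x))\<^sup>2)
    \<le> 3 * \<delta>\<^sup>2 + 32 * inverse c * inverse (real n) *
        ((\<Sum>j=1..p. (\<rho> j)\<^sup>2 * lam j) + (\<Sum>j=1..p. \<rho> j)\<^sup>2)"
proof -
  interpret prob_space P by fact
  let ?L = "lborel :: (real ^ 'd) measure"
  define \<kappa> where "\<kappa> = real n powr (- 1 / 2)"
  have \<kappa>2: "\<kappa>\<^sup>2 = inverse (real n)"
    by (simp add: \<kappa>_def powr_minus powr_half_sqrt power_inverse)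
  have QO: "l2_operator ?L \<nu> Q" using Q by (simp add: l2_adjoint_def)
  have F\<delta>_L2: "F\<delta> j \<subseteq> L2 ?L" if "j \<in> {1..p}" for j
    using F_L2[OF that] F\<delta>_sub[OF that] by blast
  have f_L2: "f \<in> L2 ?L"
  proof -
    obtain g where "\<And>j. j \<in> {1..p} \<Longrightarrow> g j \<in> F j" and g: "f = (\<lambda>x. \<Sum>j=1..p. g j x)"
      using f class_sub unfolding sum_class_def by blast
    then have "g j \<in> L2 ?L" if "j \<in> {1..p}" for j using F_L2 that by blast
    then show ?thesis unfolding g by (intro L2_sum) auto
  qed
  obtain \<phi>0 where \<phi>0: "\<phi>0 \<in> \<F>\<delta>" "l2_norm ?L (\<lambda>x. f x - \<phi>0 x) \<le> \<delta>"
    using net f by (auto simp: l2_net_def)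
  \<comment> \<open>A net point may split in several ways. One splitting is fixed for each,
    independently of the outcome, so that the distances \<open>D\<close> are deterministic.\<close>
  have "\<forall>\<phi>\<in>\<F>\<delta>. \<exists>g. (\<forall>j\<in>{1..p}. g j \<in> F\<delta> j) \<and> (\<lambda>x. \<Sum>j=1..p. g j x) = \<phi>"
    using net_sub unfolding sum_class_def by blast
  from bchoice[OF this] obtain G where G_dec:
    "\<forall>\<phi>\<in>\<F>\<delta>. (\<forall>j\<in>{1..p}. G \<phi> j \<in> F\<delta> j) \<and> (\<lambda>x. \<Sum>j=1..p. G \<phi> j x) = \<phi>" ..
  have G: "G \<phi> j \<in> F\<delta> j" if "\<phi> \<in> \<F>\<delta>" "j \<in> {1..p}" for \<phi> j
    using G_dec that by blast
  have G_sum: "(\<lambda>x. \<Sum>j=1..p. G \<phi> j x) = \<phi>" if "\<phi> \<in> \<F>\<delta>" for \<phi>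
    using G_dec that by blast
  have G_L2: "G \<phi> j \<in> L2 ?L" if "\<phi> \<in> \<F>\<delta>" "j \<in> {1..p}" for \<phi> j
    using G[OF that] F\<delta>_L2[OF that(2)] by blast
  have net_L2: "\<phi> \<in> L2 ?L" if "\<phi> \<in> \<F>\<delta>" for \<phi>
    using L2_sum[of "{1..p}" "G \<phi>" ?L] G_L2[OF that] unfolding G_sum[OF that] by blast
  define D where "D \<phi> j = l2_norm ?L (\<lambda>x. G \<phi> j x - G \<phi>0 j x)" for \<phi> j
  define X where "X \<phi> j \<omega> = W (Q (G \<phi> j)) \<omega> - W (Q (G \<phi>0 j)) \<omega>" for \<phi> j \<omega>

  \<comment> \<open>The components enter only through differences, which is where the bound on
    \<open>diff_class\<close> is used.\<close>
  have D_sum: "c * (\<Sum>j=1..p. (D \<phi> j)\<^sup>2) \<le> (l2_norm ?L (\<lambda>x. \<phi> x - \<phi>0 x))\<^sup>2"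
    if \<phi>: "\<phi> \<in> \<F>\<delta>" for \<phi>
  proof -
    have "(\<lambda>x. G \<phi> j x - G \<phi>0 j x) \<in> diff_class (F j)" if "j \<in> {1..p}" for j
      using G[OF \<phi> that] G[OF \<phi>0(1) that] F\<delta>_sub[OF that] by (auto simp: diff_class_def)
    then have "c * (\<Sum>j=1..p. (D \<phi> j)\<^sup>2) \<le>
        (l2_norm ?L (\<lambda>x. \<Sum>j=1..p. G \<phi> j x - G \<phi>0 j x))\<^sup>2"
      unfolding D_def
      using bound[unfolded sum_norm_bound_def, rule_format, of "\<lambda>j x. G \<phi> j x - G \<phi>0 j x"] by simp
    also have "(\<lambda>x. \<Sum>j=1..p. G \<phi> j x - G \<phi>0 j x) = (\<lambda>x. \<phi> x - \<phi>0 x)"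
      unfolding sum_subtractf fun_cong[OF G_sum[OF \<phi>]] fun_cong[OF G_sum[OF \<phi>0(1)]] ..
    finally show ?thesis .
  qed

  \<comment> \<open>The maximum runs over the component set \<open>F\<delta> j\<close>, with
    \<open>exp (lam j)\<close> elements, and not over the net. The reference component
    \<open>G \<phi>0 j\<close> is deterministic, so each increment is a centered Gaussian.\<close>
  have "\<exists>R. integrable P R \<and> expectation R \<le> 4 * lam j + 2 * ln 2 \<and> (\<forall>\<omega>. 0 \<le> R \<omega>) \<and>
      (AE \<omega> in P. \<forall>\<phi>\<in>\<F>\<delta>. (X \<phi> j \<omega>)\<^sup>2 \<le> (\<rho> j * D \<phi> j)\<^sup>2 * R \<omega>)" if j: "j \<in> {1..p}" for j
  proof -
    let ?v = "\<lambda>s. (l2_norm \<nu> (\<lambda>y. Q s y - Q (G \<phi>0 j) y))\<^sup>2"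
    have "0 < real (card (F\<delta> j))" using F\<delta>_card[OF j] by simp
    then have "F\<delta> j \<noteq> {}" by auto
    moreover have "centered_gaussian P (\<lambda>\<omega>. W (Q s) \<omega> - W (Q (G \<phi>0 j)) \<omega>) (?v s)"
      if "s \<in> F\<delta> j" for s
      using that F\<delta>_L2[OF j] G_L2[OF \<phi>0(1) j]
      by (intro white_noise_diff[OF W] l2_operator_L2[OF QO]) auto
    ultimately obtain R where R: "integrable P R" "expectation R \<le> 4 * ln (card (F\<delta> j)) + 2 * ln 2"
      "\<forall>\<omega>. 0 \<le> R \<omega>"
      "AE \<omega> in P. \<forall>s\<in>F\<delta> j. (W (Q s) \<omega> - W (Q (G \<phi>0 j)) \<omega>)\<^sup>2 \<le> ?v s * R \<omega>"
      using gaussian_maximal_envelope[OF P F\<delta>_finite[OF j],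
          where X = "\<lambda>s \<omega>. W (Q s) \<omega> - W (Q (G \<phi>0 j)) \<omega>" and v = ?v]
      by auto
    have v_le: "?v (G \<phi> j) \<le> (\<rho> j * D \<phi> j)\<^sup>2" if "\<phi> \<in> \<F>\<delta>" for \<phi>
      unfolding \<rho>_def D_def
      by (intro power_mono l2_norm_nonneg l2_operator_diff_norm_le_varrho[OF QO]
          F\<delta>_finite[OF j] F\<delta>_L2[OF j] G[OF that j] G[OF \<phi>0(1) j])
    have "AE \<omega> in P. \<forall>\<phi>\<in>\<F>\<delta>. (X \<phi> j \<omega>)\<^sup>2 \<le> (\<rho> j * D \<phi> j)\<^sup>2 * R \<omega>"
      using R(4)
    proof eventually_elim
      case (elim \<omega>)
      show ?case
      proof
        fix \<phi> assume \<phi>: "\<phi> \<in> \<F>\<delta>"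
        have "(X \<phi> j \<omega>)\<^sup>2 \<le> ?v (G \<phi> j) * R \<omega>"
          using elim G[OF \<phi> j] by (simp add: X_def)
        also have "\<dots> \<le> (\<rho> j * D \<phi> j)\<^sup>2 * R \<omega>"
          using R(3) by (intro mult_right_mono v_le \<phi>) auto
        finally show "(X \<phi> j \<omega>)\<^sup>2 \<le> (\<rho> j * D \<phi> j)\<^sup>2 * R \<omega>" .
      qed
    qed
    then show ?thesis using R F\<delta>_card[OF j] by auto
  qed
  then have "\<forall>j\<in>{1..p}. \<exists>R. integrable P R \<and> expectation R \<le> 4 * lam j + 2 * ln 2 \<and>
      (\<forall>\<omega>. 0 \<le> R \<omega>) \<and> (AE \<omega> in P. \<forall>\<phi>\<in>\<F>\<delta>. (X \<phi> j \<omega>)\<^sup>2 \<le> (\<rho> j * D \<phi> j)\<^sup>2 * R \<omega>)"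
    by blast
  from bchoice[OF this] obtain R where R: "\<forall>j\<in>{1..p}. integrable P (R j) \<and>
      expectation (R j) \<le> 4 * lam j + 2 * ln 2 \<and> (\<forall>\<omega>. 0 \<le> R j \<omega>) \<and>
      (AE \<omega> in P. \<forall>\<phi>\<in>\<F>\<delta>. (X \<phi> j \<omega>)\<^sup>2 \<le> (\<rho> j * D \<phi> j)\<^sup>2 * R j \<omega>)" ..
  have R_int: "integrable P (R j)" and R_E: "expectation (R j) \<le> 4 * lam j + 2 * ln 2"
    and R0: "0 \<le> R j \<omega>"
    and R_X: "AE \<omega> in P. \<forall>\<phi>\<in>\<F>\<delta>. (X \<phi> j \<omega>)\<^sup>2 \<le> (\<rho> j * D \<phi> j)\<^sup>2 * R j \<omega>"
    if "j \<in> {1..p}" for j \<omega>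
    using R that by blast+

  \<comment> \<open>The minimizer is random, so one null set has to serve all net points; finiteness
    of the net provides it.\<close>
  have W_sum: "AE \<omega> in P. \<forall>\<phi>\<in>\<F>\<delta>. W (Q \<phi>) \<omega> = (\<Sum>j=1..p. W (Q (G \<phi> j)) \<omega>)"
  proof (rule AE_finite_allI[OF net_finite])
    fix \<phi> assume \<phi>: "\<phi> \<in> \<F>\<delta>"
    have "AE y in \<nu>. Q (\<lambda>x. \<Sum>j=1..p. G \<phi> j x) y = (\<Sum>j=1..p. Q (G \<phi> j) y)"
      by (intro l2_operator_sum[OF QO] G_L2[OF \<phi>]) auto
    then show "AE \<omega> in P. W (Q \<phi>) \<omega> = (\<Sum>j=1..p. W (Q (G \<phi> j)) \<omega>)"
      unfolding G_sum[OF \<phi>]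
      by (intro white_noise_sum[OF W] l2_operator_L2[OF QO] G_L2[OF \<phi>] net_L2[OF \<phi>]) auto
  qed

  \<comment> \<open>With \<open>S\<close> the noise sum weighted by
    \<open>4 * \<kappa>^2 / c\<close>, the argument below gives
    \<open>x \<le> y + (x + y) / 2 + S\<close>, hence \<open>x \<le> 3 * y + 2 * S\<close>; this
    accounts for the 3 and the 8.\<close>
  define B where "B \<omega> = 3 * \<delta>\<^sup>2 + 8 * \<kappa>\<^sup>2 / c * (\<Sum>j=1..p. (\<rho> j)\<^sup>2 * R j \<omega>)" for \<omega>
  have R_X': "AE \<omega> in P. \<forall>j\<in>{1..p}. \<forall>\<phi>\<in>\<F>\<delta>. (X \<phi> j \<omega>)\<^sup>2 \<le> (\<rho> j * D \<phi> j)\<^sup>2 * R j \<omega>"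
    by (rule AE_finite_allI) (use R_X in auto)
  have main: "AE \<omega> in P. (l2_norm ?L (\<lambda>x. fhat \<omega> x - f x))\<^sup>2 \<le> B \<omega>"
    using W_sum R_X' AE_space
  proof eventually_elim
    case (elim \<omega>)
    let ?\<phi> = "fhat \<omega>"
    let ?x = "(l2_norm ?L (\<lambda>x. ?\<phi> x - f x))\<^sup>2" and ?y = "(l2_norm ?L (\<lambda>x. \<phi>0 x - f x))\<^sup>2"
    have \<phi>: "?\<phi> \<in> \<F>\<delta>" and "empirical_risk ?L Q (observation \<nu> W n (A f)) \<omega> ?\<phi>
        \<le> empirical_risk ?L Q (observation \<nu> W n (A f)) \<omega> \<phi>0"
      using fhat_min[OF elim(3)] \<phi>0(1) by (auto simp: is_arg_min_linorder)
    \<comment> \<open>The squared norm of \<open>f\<close> occurs in both risks and cancels.\<close>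
    then have "?x \<le> ?y + 2 * \<kappa> * (W (Q ?\<phi>) \<omega> - W (Q \<phi>0) \<omega>)"
      unfolding empirical_risk_white_noise[OF A Ainv Q f_L2 net_L2[OF \<phi>]]
        empirical_risk_white_noise[OF A Ainv Q f_L2 net_L2[OF \<phi>0(1)]] \<kappa>_def
      unfolding right_diff_distrib by linarith
    also have "W (Q ?\<phi>) \<omega> - W (Q \<phi>0) \<omega> = (\<Sum>j=1..p. X ?\<phi> j \<omega>)"
      unfolding X_def sum_subtractf using elim(1) \<phi> \<phi>0(1) by simp
    also have "2 * \<kappa> * (\<Sum>j=1..p. X ?\<phi> j \<omega>) \<le>
        (\<Sum>j=1..p. c / 4 * (D ?\<phi> j)\<^sup>2 + 4 * \<kappa>\<^sup>2 / c * ((\<rho> j)\<^sup>2 * R j \<omega>))"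
      unfolding sum_distrib_left using elim(2) \<phi> R0
      by (intro sum_mono two_mult_le_weighted_squares c) auto
    also have "\<dots> = c / 4 * (\<Sum>j=1..p. (D ?\<phi> j)\<^sup>2) + 4 * \<kappa>\<^sup>2 / c * (\<Sum>j=1..p. (\<rho> j)\<^sup>2 * R j \<omega>)"
      by (simp add: sum.distrib sum_distrib_left)
    finally have "?x \<le> ?y + c / 4 * (\<Sum>j=1..p. (D ?\<phi> j)\<^sup>2) +
        4 * \<kappa>\<^sup>2 / c * (\<Sum>j=1..p. (\<rho> j)\<^sup>2 * R j \<omega>)" by simp
    moreover have "c * (\<Sum>j=1..p. (D ?\<phi> j)\<^sup>2) \<le> 2 * ?x + 2 * ?y"
      using D_sum[OF \<phi>] l2_norm_diff_sq_le[OF net_L2[OF \<phi>] net_L2[OF \<phi>0(1)] f_L2] by simp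
    moreover have "?y \<le> \<delta>\<^sup>2"
      using \<phi>0(2) unfolding l2_norm_diff_commute[of ?L f] by (intro power_mono l2_norm_nonneg)
    ultimately show "?x \<le> B \<omega>" unfolding B_def by simp
  qed

  have const: "has_bochner_integral P (\<lambda>\<omega>. 3 * \<delta>\<^sup>2) (3 * \<delta>\<^sup>2)"
    by (simp add: has_bochner_integral_iff prob_space)
  have B_int: "has_bochner_integral P B
      (3 * \<delta>\<^sup>2 + 8 * \<kappa>\<^sup>2 / c * (\<Sum>j=1..p. (\<rho> j)\<^sup>2 * expectation (R j)))"
    unfolding B_def
    by (rule has_bochner_integral_add[OF const]) (intro has_bochner_integral_mult_right
        has_bochner_integral_sum has_bochner_integral_integrable R_int)
  have "expectation (\<lambda>\<omega>. (l2_norm ?L (\<lambda>x. fhat \<omega> x - f x))\<^sup>2) \<le> expectation B"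
  proof (rule integral_mono_AE'[OF _ main])
    show "integrable P B" using B_int by (simp add: has_bochner_integral_iff)
    show "AE \<omega> in P. 0 \<le> B \<omega>"
      using main by eventually_elim (rule order_trans[OF zero_le_power2])
  qed
  also have "\<dots> = 3 * \<delta>\<^sup>2 + 8 * \<kappa>\<^sup>2 / c * (\<Sum>j=1..p. (\<rho> j)\<^sup>2 * expectation (R j))"
    using B_int by (rule has_bochner_integral_integral_eq)
  also have "\<dots> \<le> 3 * \<delta>\<^sup>2 + 8 * \<kappa>\<^sup>2 / c *
      (4 * ((\<Sum>j=1..p. (\<rho> j)\<^sup>2 * lam j) + (\<Sum>j=1..p. \<rho> j)\<^sup>2))"
  proof -
    have \<rho>0: "0 \<le> \<rho> j" if "j \<in> {1..p}" for j
      unfolding \<rho>_def by (intro varrho_nonneg F\<delta>_finite that)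
    have "(\<rho> j)\<^sup>2 \<le> \<rho> j * (\<Sum>i=1..p. \<rho> i)" if "j \<in> {1..p}" for j
      unfolding power2_eq_square using that \<rho>0 by (intro mult_left_mono member_le_sum) auto
    then have sq: "(\<Sum>j=1..p. (\<rho> j)\<^sup>2) \<le> (\<Sum>j=1..p. \<rho> j)\<^sup>2"
      unfolding power2_eq_square[of "sum \<rho> {1..p}"] sum_distrib_right by (intro sum_mono) auto
    have "(\<Sum>j=1..p. (\<rho> j)\<^sup>2 * expectation (R j)) \<le> (\<Sum>j=1..p. (\<rho> j)\<^sup>2 * (4 * lam j + 4))"
    proof (intro sum_mono mult_left_mono)
      fix j assume "j \<in> {1..p}"
      from R_E[OF this] show "expectation (R j) \<le> 4 * lam j + 4"
        using ln_2_less_1 by linarith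
    qed simp
    also have "\<dots> = 4 * ((\<Sum>j=1..p. (\<rho> j)\<^sup>2 * lam j) + (\<Sum>j=1..p. (\<rho> j)\<^sup>2))"
      by (simp add: sum.distrib sum_distrib_left algebra_simps)
    also have "\<dots> \<le> 4 * ((\<Sum>j=1..p. (\<rho> j)\<^sup>2 * lam j) + (\<Sum>j=1..p. \<rho> j)\<^sup>2)"
      using sq by simp
    finally show ?thesis using c by (intro add_left_mono mult_left_mono) auto
  qed
  also have "\<dots> = 3 * \<delta>\<^sup>2 + 32 * inverse c * inverse (real n) *
      ((\<Sum>j=1..p. (\<rho> j)\<^sup>2 * lam j) + (\<Sum>j=1..p. \<rho> j)\<^sup>2)"
    by (simp add: \<kappa>2 divide_inverse)
  finally show ?thesis .
qed

end
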